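(* Let $B$ be an Alexandroff space and let $F$ be a topological space. Let $p\colon E\to B$ be a fiber bundle with fiber $F$. Then there exists a morphism-inverting functor $\mathcal{D}_p\colon B\to \mathbf{Top}$ such that the map $\pi_B\colon \int \mathcal{D}_p\to B$ is a fiber bundle isomorphic to $p$.
   Context: An Alexandroff space is a topological space in which arbitrary intersections of open sets are open. In an Alexandroff space $X$ each $x$ has a minimal open neighbourhood $U_x$, and $x\leq y \iff U_x\subseteq U_y$ defines a preorder; the open sets are exactly the lower sets and $U_x=\{y\in X : y\leq x\}$. An Alexandroff space is thereby identified with a preordered set and regarded as a thin category with a unique arrow (denoted $x\leq y$) from $x$ to $y$ whenever $x\leq y$. $\mathbf{Top}$ is the category of topological spaces and continuous maps. A functor is morphism-inverting if it sends every arrow to an isomorphism. Topological Grothendieck construction: for a functor $D\colon B\to\mathbf{Top}$ from an Alexandroff space $B$, $\int D=\bigcup_{b\in B}\{b\}\times D(b)$, with the topology having as basis the sets $J_D(b,V)=\bigcup_{v\in U_b}\{v\}\times D(v\leq b)^{-1}(V)$, for $b\in B$ and $V\subseteq D(b)$ open. The projection $\pi_B=\pi^D_B\colon\int D\to B$ is $\pi_B(b,x)=b$. A fiber bundle over $B$ with fiber $F$ is a continuous map $p\colon E\to B$ such that every $b\in B$ has an open neighbourhood $U$ (a trivializing neighbourhood) with a homeomorphism $\varphi_U\colon p^{-1}(U)\to U\times F$ (a trivialization map) commuting with the maps to $U$. Two fiber bundles $p\colon E\to B$, $q\colon E'\to B$ are isomorphic if there is a homeomorphism $\alpha\colon E\to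 E'$ with $q\alpha=p$. *)

theory Defs
  imports "HOL-Analysis.Analysis"
begin

text \<open>Topological spaces are values of type \<open>'a topology\<close>; the underlying set is the
  \<^const>\<open>topspace\<close>, and the behaviour of maps off the \<^const>\<open>topspace\<close> is irrelevant.\<close>

text \<open>The intersection with the \<^const>\<open>topspace\<close> makes the empty intersection the whole space.\<close>

definition alexandroff_space :: "'b topology \<Rightarrow> bool" where
  "alexandroff_space B \<longleftrightarrow>
     (\<forall>\<U>. (\<forall>U\<in>\<U>. openin B U) \<longrightarrow> openin B (topspace B \<inter> \<Inter>\<U>))"

definition min_nbhd :: "'b topology \<Rightarrow> 'b \<Rightarrow> 'b set" where
  "min_nbhd B x = topspace B \<inter> \<Inter>{U. openin B U \<and> x \<in> U}"

definition alex_le :: "'b topology \<Rightarrow> 'b \<Rightarrow> 'b \<Rightarrow> bool" where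
  "alex_le B x y \<longleftrightarrow>
     x \<in> topspace B \<and> y \<in> topspace B \<and> min_nbhd B x \<subseteq> min_nbhd B y"

lemma openin_min_nbhd: "alexandroff_space B \<Longrightarrow> openin B (min_nbhd B x)"
  unfolding min_nbhd_def alexandroff_space_def
  by (erule allE[where x = "{U. openin B U \<and> x \<in> U}"]) simp

lemma mem_min_nbhd: "x \<in> topspace B \<Longrightarrow> x \<in> min_nbhd B x"
  unfolding min_nbhd_def by blast

lemma min_nbhd_subset: "openin B U \<Longrightarrow> x \<in> U \<Longrightarrow> min_nbhd B x \<subseteq> U"
  unfolding min_nbhd_def by blast

lemma min_nbhd_subset_topspace: "min_nbhd B x \<subseteq> topspace B"
  unfolding min_nbhd_def by blast

lemma min_nbhd_eq:
  assumes "alexandroff_space B" "x \<in> topspace B"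
  shows "min_nbhd B x = {y. alex_le B y x}"
proof (intro set_eqI iffI)
  fix y assume y: "y \<in> min_nbhd B x"
  then have "y \<in> topspace B" using min_nbhd_subset_topspace by fast
  then show "y \<in> {y. alex_le B y x}"
    using assms(2) min_nbhd_subset[OF openin_min_nbhd[OF assms(1)] y]
    by (simp add: alex_le_def)
next
  fix y assume "y \<in> {y. alex_le B y x}"
  then show "y \<in> min_nbhd B x"
    using mem_min_nbhd[of y B] by (auto simp: alex_le_def)
qed

text \<open>A functor is given by its object part \<open>D\<close> and its arrow part \<open>m\<close>, where \<open>m a b\<close> is the image
  of the unique arrow \<open>a \<le> b\<close>. Maps are compared on the underlying set of their domain only.\<close>

definition top_functor ::
    "'b topology \<Rightarrow> ('b \<Rightarrow> 'a topology) \<Rightarrow> ('b \<Rightarrow> 'b \<Rightarrow> 'a \<Rightarrow> 'a) \<Rightarrow> bool" where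
  "top_functor B D m \<longleftrightarrow>
     (\<forall>a b. alex_le B a b \<longrightarrow> continuous_map (D a) (D b) (m a b)) \<and>
     (\<forall>b\<in>topspace B. \<forall>x\<in>topspace (D b). m b b x = x) \<and>
     (\<forall>a b c. alex_le B a b \<longrightarrow> alex_le B b c \<longrightarrow>
        (\<forall>x\<in>topspace (D a). m a c x = m b c (m a b x)))"

definition morphism_inverting ::
    "'b topology \<Rightarrow> ('b \<Rightarrow> 'a topology) \<Rightarrow> ('b \<Rightarrow> 'b \<Rightarrow> 'a \<Rightarrow> 'a) \<Rightarrow> bool" where
  "morphism_inverting B D m \<longleftrightarrow>
     (\<forall>a b. alex_le B a b \<longrightarrow> (\<exists>g. homeomorphic_maps (D a) (D b) (m a b) g))"

definition groth_basic ::
    "'b topology \<Rightarrow> ('b \<Rightarrow> 'a topology) \<Rightarrow> ('b \<Rightarrow> 'b \<Rightarrow> 'a \<Rightarrow> 'a) \<Rightarrow> 'b \<Rightarrow> 'a set \<Rightarrow> ('b \<times> 'a) set" where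
  "groth_basic B D m b V =
     (SIGMA v : min_nbhd B b. {x \<in> topspace (D v). m v b x \<in> V})"

definition groth_basis ::
    "'b topology \<Rightarrow> ('b \<Rightarrow> 'a topology) \<Rightarrow> ('b \<Rightarrow> 'b \<Rightarrow> 'a \<Rightarrow> 'a) \<Rightarrow> ('b \<times> 'a) set \<Rightarrow> bool" where
  "groth_basis B D m S \<longleftrightarrow>
     (\<exists>b\<in>topspace B. \<exists>V. openin (D b) V \<and> S = groth_basic B D m b V)"

text \<open>The open sets are the unions of basic sets. For a functor on an Alexandroff space this is
  indeed a topology, and its underlying set is the expected disjoint union
  (lemmas \<open>openin_groth\<close> and \<open>topspace_groth\<close>).\<close>

definition groth ::
    "'b topology \<Rightarrow> ('b \<Rightarrow> 'a topology) \<Rightarrow> ('b \<Rightarrow> 'b \<Rightarrow> 'a \<Rightarrow> 'a) \<Rightarrow> ('b \<times> 'a) topology" where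
  "groth B D m = topology (arbitrary union_of (groth_basis B D m))"

lemma istopology_groth:
  assumes B: "alexandroff_space B" and F: "top_functor B D m"
  shows "istopology (arbitrary union_of (groth_basis B D m))"
  unfolding istopology_base_eq
proof (intro allI impI, elim conjE)
  fix S T assume S: "groth_basis B D m S" and T: "groth_basis B D m T"
  obtain b V where b: "b \<in> topspace B" "openin (D b) V" "S = groth_basic B D m b V"
    using S unfolding groth_basis_def by blast
  obtain c W where c: "c \<in> topspace B" "openin (D c) W" "T = groth_basic B D m c W"
    using T unfolding groth_basis_def by blast
  have cont: "\<And>x y. alex_le B x y \<Longrightarrow> continuous_map (D x) (D y) (m x y)"
    and ident: "\<And>x z. x \<in> topspace B \<Longrightarrow> z \<in> topspace (D x) \<Longrightarrow> m x x z = z"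
    and comp: "\<And>x y z w. alex_le B x y \<Longrightarrow> alex_le B y z \<Longrightarrow> w \<in> topspace (D x)
                 \<Longrightarrow> m x z w = m y z (m x y w)"
    using F unfolding top_functor_def by blast+
  show "(arbitrary union_of groth_basis B D m) (S \<inter> T)"
    unfolding arbitrary_union_of_alt
  proof
    fix q assume q: "q \<in> S \<inter> T"
    obtain v x where vx: "q = (v, x)" by fastforce
    have v: "alex_le B v b" "alex_le B v c" and x: "x \<in> topspace (D v)" "m v b x \<in> V" "m v c x \<in> W"
      using q b c vx min_nbhd_eq[OF B] by (auto simp: groth_basic_def)
    have vB: "v \<in> topspace B" using v by (simp add: alex_le_def)
    define P where "P = {y \<in> topspace (D v). m v b y \<in> V} \<inter> {y \<in> topspace (D v). m v c y \<in> W}"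
    have "openin (D v) P"
      unfolding P_def
      by (intro openin_Int openin_continuous_map_preimage[OF cont[OF v(1)] b(2)]
          openin_continuous_map_preimage[OF cont[OF v(2)] c(2)])
    then have 1: "groth_basis B D m (groth_basic B D m v P)"
      using vB by (auto simp: groth_basis_def)
    have 2: "q \<in> groth_basic B D m v P"
      using x vx vB ident[OF vB x(1)] mem_min_nbhd[OF vB] by (auto simp: groth_basic_def P_def)
    have 3: "groth_basic B D m v P \<subseteq> S \<inter> T"
    proof
      fix r assume r: "r \<in> groth_basic B D m v P"
      obtain u y where uy: "r = (u, y)" by fastforce
      have u: "alex_le B u v" and y: "y \<in> topspace (D u)" "m u v y \<in> P"
        using r uy min_nbhd_eq[OF B vB] by (auto simp: groth_basic_def)
      have ub: "alex_le B u b" "alex_le B u c" using u v by (auto simp: alex_le_def)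
      have "m u b y \<in> V" "m u c y \<in> W"
        using comp[OF u v(1) y(1)] comp[OF u v(2) y(1)] y(2) by (auto simp: P_def)
      then show "r \<in> S \<inter> T"
        using uy y ub b c min_nbhd_eq[OF B] by (auto simp: groth_basic_def)
    qed
    show "\<exists>U. groth_basis B D m U \<and> q \<in> U \<and> U \<subseteq> S \<inter> T"
      using 1 2 3 by blast
  qed
qed

lemma openin_groth:
  assumes "alexandroff_space B" "top_functor B D m"
  shows "openin (groth B D m) = arbitrary union_of (groth_basis B D m)"
  unfolding groth_def using istopology_groth[OF assms] by (rule topology_inverse')

lemma topspace_groth:
  assumes B: "alexandroff_space B" and F: "top_functor B D m"
  shows "topspace (groth B D m) = (SIGMA b : topspace B. topspace (D b))"
proof -
  have "topspace (groth B D m) = \<Union>(Collect (groth_basis B D m))"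
  proof
    show "topspace (groth B D m) \<subseteq> \<Union>(Collect (groth_basis B D m))"
      using openin_topspace[of "groth B D m"]
      unfolding openin_groth[OF assms] arbitrary_union_of_alt by blast
    show "\<Union>(Collect (groth_basis B D m)) \<subseteq> topspace (groth B D m)"
    proof
      fix z assume "z \<in> \<Union>(Collect (groth_basis B D m))"
      then obtain S where S: "groth_basis B D m S" "z \<in> S" by blast
      then have "openin (groth B D m) S"
        unfolding openin_groth[OF assms] arbitrary_union_of_alt by blast
      then show "z \<in> topspace (groth B D m)"
        using S(2) openin_subset by blast
    qed
  qed
  also have "\<dots> = (SIGMA b : topspace B. topspace (D b))"
  proof
    show "\<Union>(Collect (groth_basis B D m)) \<subseteq> (SIGMA b : topspace B. topspace (D b))"
      using min_nbhd_subset_topspace by (fastforce simp: groth_basis_def groth_basic_def)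
    show "(SIGMA b : topspace B. topspace (D b)) \<subseteq> \<Union>(Collect (groth_basis B D m))"
    proof clarify
      fix b x assume b: "b \<in> topspace B" "x \<in> topspace (D b)"
      have "groth_basis B D m (groth_basic B D m b (topspace (D b)))"
        using b by (auto simp: groth_basis_def)
      moreover have "m b b x = x"
        using b F unfolding top_functor_def by blast
      then have "(b, x) \<in> groth_basic B D m b (topspace (D b))"
        using b mem_min_nbhd[OF b(1)] by (auto simp: groth_basic_def)
      ultimately show "(b, x) \<in> \<Union>(Collect (groth_basis B D m))" by blast
    qed
  qed
  finally show ?thesis .
qed

definition groth_proj :: "'b \<times> 'a \<Rightarrow> 'b" where
  "groth_proj = fst"

definition fiber_bundle ::
    "'e topology \<Rightarrow> 'b topology \<Rightarrow> 'f topology \<Rightarrow> ('e \<Rightarrow> 'b) \<Rightarrow> bool" where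
  "fiber_bundle E B F p \<longleftrightarrow>
     continuous_map E B p \<and>
     (\<forall>b\<in>topspace B. \<exists>U \<phi>. openin B U \<and> b \<in> U \<and>
        homeomorphic_map (subtopology E {e \<in> topspace E. p e \<in> U})
                         (prod_topology (subtopology B U) F) \<phi> \<and>
        (\<forall>e\<in>topspace E. p e \<in> U \<longrightarrow> fst (\<phi> e) = p e))"

definition bundles_isomorphic ::
    "'e topology \<Rightarrow> ('e \<Rightarrow> 'b) \<Rightarrow> 'c topology \<Rightarrow> ('c \<Rightarrow> 'b) \<Rightarrow> bool" where
  "bundles_isomorphic E p E' q \<longleftrightarrow>
     (\<exists>\<alpha>. homeomorphic_map E E' \<alpha> \<and> (\<forall>e\<in>topspace E. q (\<alpha> e) = p e))"

end

theory Submission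
  imports Defs
begin

text \<open>The fibre \<open>D(b) = p\<^sup>-\<^sup>1(b)\<close> should be moved along \<open>a \<le> b\<close> by a trivialization over a
  neighbourhood of \<open>b\<close>. Two trivializations differ by transition maps \<open>g\<^sub>u\<close> with
  \<open>g\<^sub>a f \<le> g\<^sub>b f\<close> and \<open>g\<^sub>a\<^sup>-\<^sup>1 f \<le> g\<^sub>b\<^sup>-\<^sup>1 f\<close> in the specialization preorder
  of \<open>F\<close>, so \<open>g\<^sub>a f\<close> and \<open>g\<^sub>b f\<close> are topologically indistinguishable, but not equal unless \<open>F\<close>
  is T0. Transport is thus functorial only up to indistinguishability. To make it strictly
  functorial, each indistinguishability class of each fibre is identified with a set that depends
  only on the cardinality of the class; transport is then corrected to preserve these labels, which
  does not affect any preimage of an open set.\<close>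

section \<open>Specialization and indistinguishability\<close>

text \<open>Oriented like \<open>alex_le\<close>: for points of the space it says that
  \<open>y\<close> lies in the closure of \<open>x\<close>.\<close>

definition specializes :: "'a topology \<Rightarrow> 'a \<Rightarrow> 'a \<Rightarrow> bool" where
  "specializes X x y \<longleftrightarrow> (\<forall>W. openin X W \<longrightarrow> y \<in> W \<longrightarrow> x \<in> W)"

definition indist :: "'a topology \<Rightarrow> 'a \<Rightarrow> 'a \<Rightarrow> bool" where
  "indist X x y \<longleftrightarrow> specializes X x y \<and> specializes X y x"

lemma indist_iff: "indist X x y \<longleftrightarrow> (\<forall>W. openin X W \<longrightarrow> (x \<in> W \<longleftrightarrow> y \<in> W))"
  unfolding indist_def specializes_def by blast

lemma indist_refl [simp]: "indist X x x"
  by (simp add: indist_iff)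

lemma indist_sym: "indist X x y \<Longrightarrow> indist X y x"
  by (simp add: indist_iff)

lemma indist_trans: "indist X x y \<Longrightarrow> indist X y z \<Longrightarrow> indist X x z"
  by (simp add: indist_iff)

text \<open>Stated for maps defined on a subspace because a transport is continuous only over the
  chart domain \<open>over b\<close>. The preimage of an open set is the trace of some open
  \<open>T\<close>, and \<open>T\<close> contains \<open>x\<close> as soon as it contains
  \<open>y\<close>.\<close>

lemma specializes_continuous_map:
  assumes f: "continuous_map (subtopology X S) Y f"
    and xy: "x \<in> S" "y \<in> topspace X" "y \<in> S" "specializes X x y"
  shows "specializes Y (f x) (f y)"
  unfolding specializes_def
proof (intro allI impI)
  fix W assume W: "openin Y W" "f y \<in> W"
  have "openin (subtopology X S) {z \<in> topspace (subtopology X S). f z \<in> W}"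
    using f W(1) by (rule openin_continuous_map_preimage)
  then obtain T where T: "openin X T" "{z \<in> topspace (subtopology X S). f z \<in> W} = T \<inter> S"
    unfolding openin_subtopology by blast
  have "y \<in> T" using T(2) xy W(2) by auto
  then have "x \<in> T" using T(1) xy(4) unfolding specializes_def by blast
  then show "f x \<in> W" using T(2) xy(1) by blast
qed

lemma indist_continuous_map:
  assumes "continuous_map (subtopology X S) Y f"
    and "x \<in> topspace X" "x \<in> S" "y \<in> topspace X" "y \<in> S" "indist X x y"
  shows "indist Y (f x) (f y)"
  using assms specializes_continuous_map[OF assms(1)] unfolding indist_def by blast

text \<open>Open sets cannot tell \<open>f x\<close> from \<open>g x\<close>, so \<open>f\<close>
  and \<open>g\<close> have the same preimages of open sets. This is why correcting a transport
  inside the classes keeps it continuous.\<close>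

lemma continuous_map_indist:
  assumes g: "continuous_map X Y g"
    and f: "\<And>x. x \<in> topspace X \<Longrightarrow> indist Y (f x) (g x)"
  shows "continuous_map X Y f"
proof -
  have "f x \<in> W \<longleftrightarrow> g x \<in> W" if "openin Y W" "x \<in> topspace X" for W x
    using f[OF that(2)] that(1) by (simp add: indist_iff)
  then have "{x \<in> topspace X. f x \<in> W} = {x \<in> topspace X. g x \<in> W}" if "openin Y W" for W
    using that by blast
  then show ?thesis
    using g f unfolding continuous_map_def
    by (auto simp: indist_iff Pi_iff)
qed

section \<open>Labelling by cardinality\<close>

text \<open>A canonical set of the cardinality of \<open>A\<close>, inside the same type;
  \<open>A\<close> itself shows that such a set exists.\<close>

definition card_rep :: "'a set \<Rightarrow> 'a set" where
  "card_rep A = (SOME C. A \<approx> C)"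

definition card_label :: "'a set \<Rightarrow> 'a \<Rightarrow> 'a" where
  "card_label A = (SOME f. bij_betw f A (card_rep A))"

text \<open>Equipotent sets satisfy the same predicate under \<open>SOME\<close>, so the chosen sets
  are equal and not merely equipotent.\<close>

lemma card_rep_cong:
  fixes A A' :: "'a set"
  assumes "A \<approx> A'" shows "card_rep A = card_rep A'"
proof -
  have "(A \<approx> C) = (A' \<approx> C)" for C :: "'a set"
    using assms by (meson eqpoll_sym eqpoll_trans)
  then show ?thesis by (simp add: card_rep_def)
qed

lemma bij_betw_card_label: "bij_betw (card_label A) A (card_rep A)"
proof -
  have "A \<approx> card_rep A"
    unfolding card_rep_def by (rule someI) (rule eqpoll_refl)
  then show ?thesis
    unfolding card_label_def eqpoll_def by (rule someI_ex)
qed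

section \<open>Transport in a trivialized bundle\<close>

text \<open>One chart is fixed at every base point, with its inverse \<open>\<psi> b\<close>, so
  that all later constructions refer to the same choices.\<close>

locale trivialized_bundle =
  fixes B :: "'b topology" and F :: "'f topology" and E :: "'e topology" and p :: "'e \<Rightarrow> 'b"
    and U :: "'b \<Rightarrow> 'b set" and \<phi> :: "'b \<Rightarrow> 'e \<Rightarrow> 'b \<times> 'f" and \<psi> :: "'b \<Rightarrow> 'b \<times> 'f \<Rightarrow> 'e"
  assumes alexandroff: "alexandroff_space B"
    and continuous_p: "continuous_map E B p"
    and open_U: "b \<in> topspace B \<Longrightarrow> openin B (U b)"
    and mem_U: "b \<in> topspace B \<Longrightarrow> b \<in> U b"
    and trivialization: "b \<in> topspace B \<Longrightarrow>
      homeomorphic_maps (subtopology E {e \<in> topspace E. p e \<in> U b})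
        (prod_topology (subtopology B (U b)) F) (\<phi> b) (\<psi> b)"
    and fst_trivialization:
      "b \<in> topspace B \<Longrightarrow> e \<in> topspace E \<Longrightarrow> p e \<in> U b \<Longrightarrow> fst (\<phi> b e) = p e"
begin

definition fib :: "'b \<Rightarrow> 'e set" where
  "fib b = {e \<in> topspace E. p e = b}"

definition over :: "'b \<Rightarrow> 'e set" where
  "over b = {e \<in> topspace E. p e \<in> U b}"

text \<open>In the chart at \<open>b\<close>, keep the \<open>F\<close>-coordinate of
  \<open>e\<close> and replace its base point by \<open>u\<close>. The index \<open>b\<close> only
  selects the chart; the source fibre is the one over \<open>p e\<close>.\<close>

definition transport :: "'b \<Rightarrow> 'b \<Rightarrow> 'e \<Rightarrow> 'e" where
  "transport b u e = \<psi> b (u, snd (\<phi> b e))"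

lemma p_topspace: "e \<in> topspace E \<Longrightarrow> p e \<in> topspace B"
  using continuous_p by (auto simp: continuous_map_def)

lemma le_in_U:
  assumes "alex_le B a u" "b \<in> topspace B" "u \<in> U b" shows "a \<in> U b"
  using assms mem_min_nbhd[of a B] min_nbhd_subset[OF open_U[OF assms(2)] assms(3)]
  by (auto simp: alex_le_def)

lemma p_fib: "x \<in> fib u \<Longrightarrow> p x = u"
  by (simp add: fib_def)

lemma fib_topspace: "fib u \<subseteq> topspace E"
  by (auto simp: fib_def)

lemma fib_subset_over: "u \<in> U b \<Longrightarrow> fib u \<subseteq> over b"
  by (auto simp: fib_def over_def)

context
  fixes b assumes b: "b \<in> topspace B"
begin

lemma U_subset: "U b \<subseteq> topspace B"
  using open_U[OF b] openin_subset by blast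

lemma continuous_\<phi>: "continuous_map (subtopology E (over b)) (prod_topology (subtopology B (U b)) F) (\<phi> b)"
  and continuous_\<psi>: "continuous_map (prod_topology (subtopology B (U b)) F) (subtopology E (over b)) (\<psi> b)"
  using trivialization[OF b] by (simp_all add: homeomorphic_maps_def over_def)

lemma \<psi>_\<phi>: "e \<in> over b \<Longrightarrow> \<psi> b (\<phi> b e) = e"
  using trivialization[OF b] by (auto simp: homeomorphic_maps_def over_def)

lemma \<phi>_\<psi>: "u \<in> U b \<Longrightarrow> f \<in> topspace F \<Longrightarrow> \<phi> b (\<psi> b (u, f)) = (u, f)"
  using trivialization[OF b] U_subset by (auto simp: homeomorphic_maps_def)

lemma \<phi>_eq: "e \<in> over b \<Longrightarrow> \<phi> b e = (p e, snd (\<phi> b e))"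
  using fst_trivialization[OF b] by (simp add: over_def prod_eq_iff)

lemma snd_\<phi>: "e \<in> over b \<Longrightarrow> snd (\<phi> b e) \<in> topspace F"
  using continuous_\<phi> by (auto simp: continuous_map_def over_def mem_Times_iff Pi_iff)

lemma \<psi>_over: "u \<in> U b \<Longrightarrow> f \<in> topspace F \<Longrightarrow> \<psi> b (u, f) \<in> over b"
  using continuous_\<psi> U_subset by (auto simp: continuous_map_def Pi_iff)

lemma \<phi>_transport: "u \<in> U b \<Longrightarrow> e \<in> over b \<Longrightarrow> \<phi> b (transport b u e) = (u, snd (\<phi> b e))"
  by (simp add: transport_def \<phi>_\<psi> snd_\<phi>)

lemma transport_fib:
  assumes "u \<in> U b" "e \<in> over b" shows "transport b u e \<in> fib u"
proof -
  have t: "transport b u e \<in> over b"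
    using assms by (simp add: transport_def \<psi>_over snd_\<phi>)
  then show ?thesis
    using \<phi>_eq[OF t] \<phi>_transport[OF assms] by (simp add: fib_def over_def)
qed

text \<open>Within a single chart the \<open>F\<close>-coordinate never changes, so composition is
  strict here; it can fail only when charts are mixed.\<close>

lemma transport_transport:
  "u \<in> U b \<Longrightarrow> e \<in> over b \<Longrightarrow> transport b v (transport b u e) = transport b v e"
  using \<phi>_transport by (simp add: transport_def[of b v])

lemma transport_self: "e \<in> fib u \<Longrightarrow> u \<in> U b \<Longrightarrow> transport b u e = e"
  using \<phi>_eq[of e] \<psi>_\<phi>[of e] by (auto simp: transport_def fib_def over_def)

lemma continuous_transport:
  assumes u: "u \<in> U b"
  shows "continuous_map (subtopology E (over b)) E (transport b u)"
proof -
  have 1: "continuous_map (subtopology E (over b)) F (\<lambda>e. snd (\<phi> b e))"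
    using continuous_map_compose[OF continuous_\<phi> continuous_map_snd] by (simp add: o_def)
  have "continuous_map (subtopology E (over b)) (prod_topology (subtopology B (U b)) F)
      (\<lambda>e. (u, snd (\<phi> b e)))"
    using 1 u U_subset by (auto simp: continuous_map_pairwise o_def)
  from continuous_map_compose[OF this continuous_\<psi>] show ?thesis
    by (simp add: o_def transport_def[abs_def] continuous_map_in_subtopology)
qed

lemma continuous_transport_fib:
  assumes "u \<in> U b" "v \<in> U b"
  shows "continuous_map (subtopology E (fib u)) (subtopology E (fib v)) (transport b v)"
  using continuous_map_from_subtopology_mono[OF continuous_transport[OF assms(2)]
      fib_subset_over[OF assms(1)]] transport_fib[OF assms(2)] fib_subset_over[OF assms(1)]
  by (auto simp: continuous_map_in_subtopology)

text \<open>An open box around the point in the chart has a base factor that is open in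
  \<open>B\<close>, hence contains the minimal neighbourhood of \<open>u\<close>. The second factor
  \<open>N\<close> therefore works uniformly over \<open>min_nbhd B u\<close>.\<close>

lemma tube_nbhd:
  assumes u: "u \<in> U b" and e: "e \<in> fib u" and W: "openin E W" "e \<in> W"
  shows "\<exists>N. openin F N \<and> snd (\<phi> b e) \<in> N \<and>
    (\<forall>y\<in>over b. p y \<in> min_nbhd B u \<longrightarrow> snd (\<phi> b y) \<in> N \<longrightarrow> y \<in> W)"
proof -
  let ?P = "prod_topology (subtopology B (U b)) F"
  have eo: "e \<in> over b" using e u fib_subset_over by blast
  have fe: "\<phi> b e = (u, snd (\<phi> b e))"
    using \<phi>_eq[OF eo] unfolding p_fib[OF e] .
  have "continuous_map ?P E (\<psi> b)"
    using continuous_\<psi> by (simp add: continuous_map_in_subtopology)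
  then have Z: "openin ?P {z \<in> topspace ?P. \<psi> b z \<in> W}"
    using W(1) by (rule openin_continuous_map_preimage)
  have "\<psi> b (u, snd (\<phi> b e)) = e"
    by (subst fe[symmetric]) (rule \<psi>_\<phi>[OF eo])
  moreover have "u \<in> topspace B" using u U_subset by blast
  ultimately have "(u, snd (\<phi> b e)) \<in> {z \<in> topspace ?P. \<psi> b z \<in> W}"
    using snd_\<phi>[OF eo] u W(2) by simp
  from openin_prod_topology_alt[THEN iffD1, OF Z, rule_format, OF this]
  obtain M N where MN: "openin (subtopology B (U b)) M" "openin F N" "u \<in> M"
      "snd (\<phi> b e) \<in> N" "M \<times> N \<subseteq> {z \<in> topspace ?P. \<psi> b z \<in> W}"
    by (elim exE conjE)
  have "openin B M"
    using MN(1) openin_open_subtopology[OF open_U[OF b]] by blast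
  then have M: "min_nbhd B u \<subseteq> M" using MN(3) by (rule min_nbhd_subset)
  have "y \<in> W" if "y \<in> over b" "p y \<in> min_nbhd B u" "snd (\<phi> b y) \<in> N" for y
  proof -
    have "\<phi> b y \<in> M \<times> N"
      by (subst \<phi>_eq[OF that(1)]) (use that M in blast)
    from subsetD[OF MN(5) this] have "\<psi> b (\<phi> b y) \<in> W" by (rule CollectE) (elim conjE)
    then show ?thesis by (simp only: \<psi>_\<phi>[OF that(1)])
  qed
  then show ?thesis using MN(2,4) by (intro exI[of _ N] conjI ballI impI)
qed

text \<open>A neighbourhood of the transported point contains a tube over
  \<open>min_nbhd B u\<close>. Since \<open>a\<close> lies below \<open>u\<close> and the
  \<open>F\<close>-coordinate is unchanged, \<open>e\<close> lies in this tube.\<close>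

lemma specializes_transport:
  assumes au: "alex_le B a u" and u: "u \<in> U b" and e: "e \<in> fib a"
  shows "specializes E e (transport b u e)"
  unfolding specializes_def
proof (intro allI impI)
  fix W assume W: "openin E W" "transport b u e \<in> W"
  have eo: "e \<in> over b" using e le_in_U[OF au b u] fib_subset_over by blast
  obtain N where N: "openin F N" "snd (\<phi> b (transport b u e)) \<in> N"
    "\<forall>y\<in>over b. p y \<in> min_nbhd B u \<longrightarrow> snd (\<phi> b y) \<in> N \<longrightarrow> y \<in> W"
    using tube_nbhd[OF u transport_fib[OF u eo] W] by (elim exE conjE)
  have "p e \<in> min_nbhd B u"
    using e au mem_min_nbhd[of a B] by (auto simp: fib_def alex_le_def)
  moreover have "snd (\<phi> b e) \<in> N" using N(2) \<phi>_transport[OF u eo] by simp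
  ultimately show "e \<in> W" by (rule N(3)[rule_format, OF eo])
qed

end

lemma indist_transport:
  assumes b: "b \<in> topspace B" and u: "u \<in> U b" "v \<in> U b"
    and xy: "x \<in> fib u" "y \<in> fib u" "indist E x y"
  shows "indist E (transport b v x) (transport b v y)"
proof (rule indist_continuous_map[OF continuous_transport[OF b u(2)] _ _ _ _ xy(3)])
  show "x \<in> topspace E" "y \<in> topspace E" using xy fib_topspace by blast+
  show "x \<in> over b" "y \<in> over b" using xy fib_subset_over[OF u(1)] by blast+
qed

text \<open>Functoriality up to indistinguishability: each of the two specializations comes from
  moving \<open>e\<close> upwards and then applying a continuous transport.\<close>

lemma transport_comp:
  assumes ab: "alex_le B a b" and bc: "alex_le B b c" and e: "e \<in> fib a"
  shows "indist E (transport c c (transport b b e)) (transport c c e)"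
proof -
  have B: "b \<in> topspace B" "c \<in> topspace B" using ab bc by (auto simp: alex_le_def)
  have U: "a \<in> U b" "b \<in> U b" "b \<in> U c" "c \<in> U c" "a \<in> U c"
    using le_in_U[OF ab B(1) mem_U[OF B(1)]] mem_U[OF B(1)] mem_U[OF B(2)]
      le_in_U[OF bc B(2) mem_U[OF B(2)]] le_in_U[OF ab B(2)] by blast+
  have o: "e \<in> over b" "e \<in> over c" using e U fib_subset_over by blast+
  \<comment> \<open>The competitor of \<open>transport b b e\<close> in the fibre over
    \<open>b\<close>, obtained with the chart at \<open>c\<close>; being strict in that chart, its
    transport to \<open>c\<close> is that of \<open>e\<close>.\<close>
  define y where "y = transport c b e"
  have y: "y \<in> fib b" unfolding y_def by (rule transport_fib[OF B(2) U(3) o(2)])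
  have tb: "transport b b e \<in> fib b" by (rule transport_fib[OF B(1) U(2) o(1)])
  have oc: "y \<in> over c" "transport b b e \<in> over c" and ob: "y \<in> over b"
    using y tb U fib_subset_over by blast+
  have T: "over b \<subseteq> topspace E" "over c \<subseteq> topspace E" by (auto simp: over_def)
  have 1: "specializes E (transport c c e) (transport c c (transport b b e))"
    using specializes_continuous_map[OF continuous_transport[OF B(2) U(4)] o(2) _ oc(2)]
      specializes_transport[OF B(1) ab U(2) e] oc(2) T by blast
  \<comment> \<open>For the other direction, \<open>e\<close> specializes \<open>y\<close>; applying
    \<open>transport b b\<close> fixes \<open>y\<close>, and then \<open>transport c c\<close> is
    applied.\<close>
  have "specializes E e y"
    unfolding y_def by (rule specializes_transport[OF B(2) ab U(3) e])
  then have "specializes E (transport b b e) (transport b b y)"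
    using specializes_continuous_map[OF continuous_transport[OF B(1) U(2)] o(1) _ ob] ob T by blast
  then have "specializes E (transport b b e) y"
    using transport_self[OF B(1) y U(2)] by simp
  then have "specializes E (transport c c (transport b b e)) (transport c c y)"
    using specializes_continuous_map[OF continuous_transport[OF B(2) U(4)] oc(2) _ oc(1)] oc T by blast
  moreover have "transport c c y = transport c c e"
    unfolding y_def by (rule transport_transport[OF B(2) U(3) o(2)])
  ultimately show ?thesis using 1 by (simp add: indist_def)
qed

section \<open>Strictly functorial transport\<close>

text \<open>Cut down to one fibre, since points of different fibres can be indistinguishable in
  \<open>E\<close> when \<open>B\<close> is not T0.\<close>

definition indist_class :: "'e \<Rightarrow> 'e set" where
  "indist_class x = {y \<in> fib (p x). indist E y x}"

definition label :: "'e \<Rightarrow> 'e" where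
  "label x = card_label (indist_class x) x"

definition relabel :: "('e \<Rightarrow> 'e) \<Rightarrow> 'e \<Rightarrow> 'e" where
  "relabel h x = (THE y. y \<in> indist_class (h x) \<and> label y = label x)"

lemma indist_class_eq: "y \<in> indist_class x \<Longrightarrow> indist_class y = indist_class x"
  by (auto simp: indist_class_def fib_def intro: indist_trans indist_sym)

text \<open>All members of a class have the same class, so \<open>label\<close> is one single
  labelling bijection there.\<close>

lemma bij_betw_label: "bij_betw label (indist_class x) (card_rep (indist_class x))"
  using bij_betw_card_label[of "indist_class x"]
  by (rule iffD1[OF bij_betw_cong, rotated]) (simp add: label_def indist_class_eq)

text \<open>The transports from \<open>u\<close> to \<open>v\<close> and back in one chart are
  mutually inverse on the fibres, and continuity makes both preserve indistinguishability.\<close>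

lemma bij_betw_transport_class:
  assumes b: "b \<in> topspace B" and u: "u \<in> U b" and v: "v \<in> U b" and x: "x \<in> fib u"
  shows "bij_betw (transport b v) (indist_class x) (indist_class (transport b v x))"
proof (rule bij_betw_byWitness[where f' = "transport b u"])
  have o: "fib u \<subseteq> over b" "fib v \<subseteq> over b" using u v fib_subset_over by blast+
  have tx: "transport b v x \<in> fib v" using x o transport_fib[OF b v] by blast
  have cls: "indist_class x = {y \<in> fib u. indist E y x}"
      "indist_class (transport b v x) = {y \<in> fib v. indist E y (transport b v x)}"
    by (simp_all add: indist_class_def p_fib[OF x] p_fib[OF tx])
  have inverse: "transport b u (transport b v y) = y" if "y \<in> fib u" for y
    using transport_transport[OF b v, of y u] transport_self[OF b that u] that o by auto
  show "\<forall>y\<in>indist_class x. transport b u (transport b v y) = y"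
    by (simp add: cls inverse)
  show "\<forall>y\<in>indist_class (transport b v x). transport b v (transport b u y) = y"
    using transport_transport[OF b u, of _ v] transport_self[OF b _ v] o by (auto simp: cls)
  show "transport b v ` indist_class x \<subseteq> indist_class (transport b v x)"
    using transport_fib[OF b v] o indist_transport[OF b u v] x by (auto simp: cls)
  show "transport b u ` indist_class (transport b v x) \<subseteq> indist_class x"
    using transport_fib[OF b u] o indist_transport[OF b v u _ tx] inverse[OF x] by (auto simp: cls)
qed

text \<open>The two classes are equipotent, so their labels run through the same set, each exactly
  once. This makes the \<open>THE\<close> in \<open>relabel\<close> well defined.\<close>

lemma relabel_transport_ex1:
  assumes "b \<in> topspace B" "u \<in> U b" "v \<in> U b" "x \<in> fib u"
  shows "\<exists>!y. y \<in> indist_class (transport b v x) \<and> label y = label x"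
proof -
  let ?C = "indist_class (transport b v x)"
  have "card_rep (indist_class x) = card_rep ?C"
    using bij_betw_transport_class[OF assms] by (intro card_rep_cong) (auto simp: eqpoll_def)
  moreover have "x \<in> indist_class x"
    using assms(4) by (simp add: indist_class_def fib_def)
  then have "label x \<in> card_rep (indist_class x)"
    using bij_betw_label[of x] bij_betwE by blast
  ultimately have "label x \<in> label ` ?C"
    using bij_betw_imp_surj_on[OF bij_betw_label, of "transport b v x"] by (simp only:)
  then obtain y where y: "label x = label y" "y \<in> ?C" by (rule imageE)
  show ?thesis
  proof (rule ex1I[of _ y])
    fix z assume "z \<in> ?C \<and> label z = label x"
    then show "z = y"
      using inj_onD[OF bij_betw_imp_inj_on[OF bij_betw_label], of z y "transport b v x"] y by simp
  qed (use y in simp)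
qed

context
  fixes b u v x
  assumes asm: "b \<in> topspace B" "u \<in> U b" "v \<in> U b" "x \<in> fib u"
begin

lemma p_transport: "p (transport b v x) = v"
  using transport_fib[OF asm(1,3)] fib_subset_over[OF asm(2)] asm(4) p_fib by blast

lemma relabel_transport:
  shows relabel_fib: "relabel (transport b v) x \<in> fib v"
    and relabel_indist: "indist E (relabel (transport b v) x) (transport b v x)"
    and label_relabel: "label (relabel (transport b v) x) = label x"
  using theI'[OF relabel_transport_ex1[OF asm]]
  unfolding relabel_def by (auto simp: indist_class_def p_transport)

lemma relabel_unique:
  assumes "y \<in> fib v" "indist E y (transport b v x)" "label y = label x"
  shows "relabel (transport b v) x = y"
  unfolding relabel_def using assms
  by (intro the1_equality[OF relabel_transport_ex1[OF asm]])
    (simp add: indist_class_def p_transport)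

end

lemma continuous_relabel:
  assumes b: "b \<in> topspace B" and u: "u \<in> U b" and v: "v \<in> U b"
  shows "continuous_map (subtopology E (fib u)) (subtopology E (fib v)) (relabel (transport b v))"
proof (rule continuous_map_indist[OF continuous_transport_fib[OF b u v]])
  fix x assume "x \<in> topspace (subtopology E (fib u))"
  then have x: "x \<in> fib u" by simp
  have "transport b v x \<in> fib v" using transport_fib[OF b v] x fib_subset_over[OF u] by blast
  then show "indist (subtopology E (fib v)) (relabel (transport b v) x) (transport b v x)"
    using relabel_fib[OF b u v x] relabel_indist[OF b u v x]
    by (auto simp: indist_iff openin_subtopology)
qed

text \<open>By uniqueness: \<open>x\<close> carries the right label and, up to indistinguishability,
  is the point that the chart transports back to.\<close>

lemma relabel_relabel:
  assumes b: "b \<in> topspace B" and u: "u \<in> U b" and v: "v \<in> U b" and x: "x \<in> fib u"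
  shows "relabel (transport b u) (relabel (transport b v) x) = x"
proof (rule relabel_unique[OF b v u relabel_fib[OF b u v x] x])
  have o: "x \<in> over b" using x fib_subset_over[OF u] by blast
  have "indist E (transport b u (relabel (transport b v) x)) (transport b u (transport b v x))"
    using indist_transport[OF b v u relabel_fib[OF b u v x] _ relabel_indist[OF b u v x]]
      transport_fib[OF b v o] .
  then show "indist E x (transport b u (relabel (transport b v) x))"
    using transport_transport[OF b v o] transport_self[OF b x u] by (simp add: indist_sym)
  show "label x = label (relabel (transport b v) x)"
    using label_relabel[OF b u v x] by simp
qed

definition fibre_space :: "'b \<Rightarrow> 'e topology" where
  "fibre_space b = subtopology E (fib b)"

text \<open>The chart is taken at the upper point \<open>b\<close>, because the open set
  \<open>U b\<close> contains everything below \<open>b\<close>.\<close>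

definition fibre_map :: "'b \<Rightarrow> 'b \<Rightarrow> 'e \<Rightarrow> 'e" where
  "fibre_map a b = relabel (transport b b)"

lemma topspace_fibre_space: "topspace (fibre_space b) = fib b"
  by (auto simp: fibre_space_def fib_def)

lemma le_U:
  assumes "alex_le B a b" shows "b \<in> topspace B" "a \<in> U b" "b \<in> U b"
proof -
  show b: "b \<in> topspace B" using assms by (simp add: alex_le_def)
  show "b \<in> U b" by (rule mem_U[OF b])
  then show "a \<in> U b" by (rule le_in_U[OF assms b])
qed

lemma top_functor_fibre: "top_functor B fibre_space fibre_map"
  unfolding top_functor_def topspace_fibre_space
proof (intro conjI allI impI ballI)
  fix a b assume "alex_le B a b"
  then show "continuous_map (fibre_space a) (fibre_space b) (fibre_map a b)"
    using continuous_relabel le_U by (simp add: fibre_space_def fibre_map_def)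
next
  fix b x assume b: "b \<in> topspace B" and x: "x \<in> fib b"
  then show "fibre_map b b x = x"
    unfolding fibre_map_def
    using relabel_unique[OF b mem_U[OF b] mem_U[OF b] x x] transport_self[OF b x mem_U[OF b]]
    by simp
next
  fix a b c x assume ab: "alex_le B a b" and bc: "alex_le B b c" and x: "x \<in> fib a"
  have ac: "alex_le B a c" using ab bc by (auto simp: alex_le_def)
  note ab' = le_U[OF ab] and bc' = le_U[OF bc] and ac' = le_U[OF ac]
  let ?y = "relabel (transport b b) x"
  let ?z = "relabel (transport c c) ?y"
  have y: "?y \<in> fib b" "indist E ?y (transport b b x)" "label ?y = label x"
    using relabel_transport[OF ab' x] by blast+
  have z: "?z \<in> fib c" "indist E ?z (transport c c ?y)" "label ?z = label ?y"
    using relabel_transport[OF bc' y(1)] by blast+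
  have "indist E (transport c c ?y) (transport c c (transport b b x))"
    using indist_transport[OF bc' y(1) _ y(2)] transport_fib[OF ab'(1,3)] x
      fib_subset_over[OF ab'(2)] by blast
  \<comment> \<open>The composite thus lies in the class prescribed for the direct map and carries
    the label of \<open>x\<close>, so uniqueness turns indistinguishability into equality.\<close>
  then have "indist E ?z (transport c c x)"
    by (rule indist_trans[OF z(2) indist_trans[OF _ transport_comp[OF ab bc x]]])
  then show "fibre_map a c x = fibre_map b c (fibre_map a b x)"
    unfolding fibre_map_def
    by (rule relabel_unique[OF ac' x z(1) _ trans[OF z(3) y(3)]])
qed

lemma morphism_inverting_fibre: "morphism_inverting B fibre_space fibre_map"
  unfolding morphism_inverting_def
proof (intro allI impI)
  fix a b assume "alex_le B a b"
  note U = le_U[OF this]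
  \<comment> \<open>The inverse moves back within the same chart, the one at \<open>b\<close>,
    rather than using a chart at \<open>a\<close>.\<close>
  have "homeomorphic_maps (fibre_space a) (fibre_space b) (fibre_map a b) (relabel (transport b a))"
    unfolding homeomorphic_maps_def topspace_fibre_space
    using continuous_relabel[OF U] continuous_relabel[OF U(1,3,2)]
      relabel_relabel[OF U] relabel_relabel[OF U(1,3,2)]
    by (simp add: fibre_space_def fibre_map_def)
  then show "\<exists>g. homeomorphic_maps (fibre_space a) (fibre_space b) (fibre_map a b) g"
    by blast
qed

section \<open>The Grothendieck construction recovers the bundle\<close>

abbreviation G :: "('b \<times> 'e) topology" where
  "G \<equiv> groth B fibre_space fibre_map"

lemma topspace_G: "topspace G = (SIGMA b : topspace B. fib b)"
  using topspace_groth[OF alexandroff top_functor_fibre] by (simp add: topspace_fibre_space)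

lemma fibre_map_mem_iff:
  assumes "alex_le B v b" "x \<in> fib v" "openin E W"
  shows "fibre_map v b x \<in> W \<longleftrightarrow> transport b b x \<in> W"
  using relabel_indist[OF le_U[OF assms(1)] assms(2)] assms(3)
  by (simp add: fibre_map_def indist_iff)

lemma fibre_map_fib:
  assumes "alex_le B v b" "x \<in> fib v" shows "fibre_map v b x \<in> fib b"
  unfolding fibre_map_def by (rule relabel_fib[OF le_U[OF assms(1)] assms(2)])

text \<open>Writing an open set of the fibre as the trace of \<open>W\<close> removes the
  relabelling from basic sets: only the transport, which is continuous on all of
  \<open>over b\<close>, remains.\<close>

lemma mem_groth_basic_iff:
  assumes b: "b \<in> topspace B" and W: "openin E W"
  shows "(v, x) \<in> groth_basic B fibre_space fibre_map b (W \<inter> fib b) \<longleftrightarrow>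
    v \<in> min_nbhd B b \<and> x \<in> fib v \<and> transport b b x \<in> W"
proof (cases "v \<in> min_nbhd B b \<and> x \<in> fib v")
  case True
  then have "alex_le B v b" using min_nbhd_eq[OF alexandroff b] by blast
  then show ?thesis
    using True fibre_map_mem_iff[OF _ _ W] fibre_map_fib
    by (simp add: groth_basic_def topspace_fibre_space)
next
  case False
  then show ?thesis by (auto simp: groth_basic_def topspace_fibre_space)
qed

lemma openin_snd_image_basic:
  assumes "groth_basis B fibre_space fibre_map S"
  shows "openin E (snd ` S)"
proof -
  obtain b V where b: "b \<in> topspace B" and V: "openin (fibre_space b) V"
    and S: "S = groth_basic B fibre_space fibre_map b V"
    using assms unfolding groth_basis_def by blast
  obtain W where W: "openin E W" "V = W \<inter> fib b"
    using V by (auto simp: fibre_space_def openin_subtopology)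
  have over_open: "openin E (over b)"
    unfolding over_def by (rule openin_continuous_map_preimage[OF continuous_p open_U[OF b]])
  have nbhd: "min_nbhd B b \<subseteq> U b" by (rule min_nbhd_subset[OF open_U[OF b] mem_U[OF b]])
  \<comment> \<open>The image is an intersection of preimages of open sets under \<open>p\<close>
    and under the transport to \<open>b\<close>; the minimal neighbourhood of \<open>b\<close> is
    open because \<open>B\<close> is Alexandroff.\<close>
  have "snd ` S = {e \<in> topspace E. p e \<in> min_nbhd B b} \<inter>
      {e \<in> topspace (subtopology E (over b)). transport b b e \<in> W}"
    (is "_ = ?P \<inter> ?Q")
  proof
    show "snd ` S \<subseteq> ?P \<inter> ?Q"
    proof
      fix e assume "e \<in> snd ` S"
      then obtain v where "(v, e) \<in> S" by force
      then have "v \<in> min_nbhd B b" "e \<in> fib v" "transport b b e \<in> W"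
        by (simp_all add: S W(2) mem_groth_basic_iff[OF b W(1)])
      then show "e \<in> ?P \<inter> ?Q" using nbhd by (auto simp: fib_def over_def)
    qed
    show "?P \<inter> ?Q \<subseteq> snd ` S"
    proof
      fix e assume "e \<in> ?P \<inter> ?Q"
      then have "p e \<in> min_nbhd B b" "e \<in> fib (p e)" "transport b b e \<in> W"
        by (simp_all add: fib_def)
      then have "(p e, e) \<in> S"
        by (simp add: S W(2) mem_groth_basic_iff[OF b W(1)])
      then show "e \<in> snd ` S" by (rule rev_image_eqI) simp
    qed
  qed
  moreover have "openin E ?P"
    by (rule openin_continuous_map_preimage[OF continuous_p openin_min_nbhd[OF alexandroff]])
  moreover have "openin E ?Q"
    using openin_continuous_map_preimage[OF continuous_transport[OF b mem_U[OF b]] W(1)]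
      openin_open_subtopology[OF over_open] by blast
  ultimately show ?thesis by (simp add: openin_Int)
qed

lemma open_map_snd_G: "open_map G E snd"
  unfolding open_map_def
proof (intro allI impI)
  fix O' assume "openin G O'"
  then obtain \<S> where \<S>: "\<And>S. S \<in> \<S> \<Longrightarrow> groth_basis B fibre_space fibre_map S" "O' = \<Union>\<S>"
    unfolding openin_groth[OF alexandroff top_functor_fibre] union_of_def by blast
  have "snd ` O' = \<Union>((`) snd ` \<S>)" unfolding \<S>(2) by blast
  then show "openin E (snd ` O')"
    using \<S>(1) openin_snd_image_basic by (auto intro!: openin_Union)
qed

lemma continuous_snd_G: "continuous_map G E snd"
  unfolding continuous_map_def
proof (intro conjI allI impI)
  show "snd \<in> topspace G \<rightarrow> topspace E" by (auto simp: topspace_G fib_def)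
  fix W assume W: "openin E W"
  show "openin G {z \<in> topspace G. snd z \<in> W}"
    unfolding openin_groth[OF alexandroff top_functor_fibre] arbitrary_union_of_alt
  proof
    fix z assume "z \<in> {z \<in> topspace G. snd z \<in> W}"
    then obtain b e where z: "z = (b, e)" and b: "b \<in> topspace B" and e: "e \<in> fib b" "e \<in> W"
      by (auto simp: topspace_G)
    have bU: "b \<in> U b" by (rule mem_U[OF b])
    have eo: "e \<in> over b" using e fib_subset_over[OF bU] by blast
    obtain N where N: "openin F N" "snd (\<phi> b e) \<in> N"
      "\<forall>y\<in>over b. p y \<in> min_nbhd B b \<longrightarrow> snd (\<phi> b y) \<in> N \<longrightarrow> y \<in> W"
      using tube_nbhd[OF b bU e(1) W e(2)] by (elim exE conjE)
    have over_open: "openin E (over b)"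
      unfolding over_def by (rule openin_continuous_map_preimage[OF continuous_p open_U[OF b]])
    \<comment> \<open>The part of the chart with \<open>F\<close>-coordinate in \<open>N\<close>.
      Transport to \<open>b\<close> keeps this coordinate, so the basic set cut out by
      \<open>V\<close> projects into the tube, hence into \<open>W\<close>.\<close>
    define V where "V = {y \<in> topspace (subtopology E (over b)). snd (\<phi> b y) \<in> N}"
    have "continuous_map (subtopology E (over b)) F (\<lambda>y. snd (\<phi> b y))"
      using continuous_map_compose[OF continuous_\<phi>[OF b] continuous_map_snd] by (simp add: o_def)
    then have "openin (subtopology E (over b)) V"
      unfolding V_def using N(1) by (rule openin_continuous_map_preimage)
    then have V: "openin E V" using openin_open_subtopology[OF over_open] by blast
    let ?S = "groth_basic B fibre_space fibre_map b (V \<inter> fib b)"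
    have "groth_basis B fibre_space fibre_map ?S"
      using b V by (auto simp: groth_basis_def fibre_space_def openin_subtopology)
    moreover have "e \<in> V"
      using e(1) eo N(2) fib_topspace by (auto simp: V_def)
    then have "z \<in> ?S"
      using z e(1) transport_self[OF b e(1) bU] mem_min_nbhd[OF b]
      by (simp add: mem_groth_basic_iff[OF b V])
    moreover have "?S \<subseteq> {z \<in> topspace G. snd z \<in> W}"
    proof
      fix z assume "z \<in> ?S"
      then obtain v y where z: "z = (v, y)"
        and y: "v \<in> min_nbhd B b" "y \<in> fib v" "transport b b y \<in> V"
        by (cases z) (simp add: mem_groth_basic_iff[OF b V])
      have o: "y \<in> over b"
        using y(1,2) min_nbhd_subset[OF open_U[OF b] bU] fib_subset_over by blast
      have "snd (\<phi> b y) \<in> N"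
        using y(3) \<phi>_transport[OF b bU o] by (simp add: V_def)
      then have "y \<in> W" using N(3)[rule_format, OF o] y(1) p_fib[OF y(2)] by simp
      then show "z \<in> {z \<in> topspace G. snd z \<in> W}"
        using z y(1,2) min_nbhd_subset_topspace[of B b] by (auto simp: topspace_G)
    qed
    ultimately show "\<exists>S. groth_basis B fibre_space fibre_map S \<and> z \<in> S \<and>
        S \<subseteq> {z \<in> topspace G. snd z \<in> W}"
      by blast
  qed
qed

text \<open>Forgetting the base point loses nothing, since \<open>p\<close> recovers it from the
  point of \<open>E\<close>.\<close>

lemma homeomorphic_map_snd_G: "homeomorphic_map G E snd"
proof (rule bijective_open_imp_homeomorphic_map[OF continuous_snd_G open_map_snd_G])
  have "topspace E \<subseteq> snd ` topspace G"
  proof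
    fix e assume "e \<in> topspace E"
    then have "(p e, e) \<in> topspace G" by (simp add: topspace_G fib_def p_topspace)
    then show "e \<in> snd ` topspace G" by force
  qed
  then show "snd ` topspace G = topspace E" by (auto simp: topspace_G fib_def)
  show "inj_on snd (topspace G)" by (auto simp: inj_on_def topspace_G fib_def)
qed

end

section \<open>Transfer of local triviality along a homeomorphism, and the theorem\<close>

lemma fiber_bundle_homeomorphic:
  assumes p: "fiber_bundle E B F p" and h: "homeomorphic_map E' E h"
    and q: "\<And>e. e \<in> topspace E' \<Longrightarrow> p (h e) = q e"
  shows "fiber_bundle E' B F q"
  unfolding fiber_bundle_def
proof (intro conjI ballI)
  have cont: "continuous_map E' E h" and img: "h ` topspace E' = topspace E"
    using h by (simp_all add: homeomorphic_imp_continuous_map homeomorphic_imp_surjective_map)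
  have mem: "h e \<in> topspace E" if "e \<in> topspace E'" for e using img that by blast
  have "continuous_map E' B (p \<circ> h)"
    using cont p by (auto simp: fiber_bundle_def intro: continuous_map_compose)
  then show "continuous_map E' B q"
    by (rule continuous_map_eq) (simp add: q)
  fix b assume "b \<in> topspace B"
  then obtain U \<phi> where U: "openin B U" "b \<in> U"
    and \<phi>: "homeomorphic_map (subtopology E {e \<in> topspace E. p e \<in> U})
      (prod_topology (subtopology B U) F) \<phi>"
    and fst: "\<And>e. e \<in> topspace E \<Longrightarrow> p e \<in> U \<Longrightarrow> fst (\<phi> e) = p e"
    using p unfolding fiber_bundle_def by blast
  have "h ` (topspace E' \<inter> {e \<in> topspace E'. q e \<in> U}) = topspace E \<inter> {e \<in> topspace E. p e \<in> U}"
    using q mem by (auto simp flip: img)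
  then have "homeomorphic_map (subtopology E' {e \<in> topspace E'. q e \<in> U})
      (subtopology E {e \<in> topspace E. p e \<in> U}) h"
    using h by (intro homeomorphic_map_subtopologies) auto
  \<comment> \<open>The new trivialization is the old one preceded by the restriction of
    \<open>h\<close>.\<close>
  then have "homeomorphic_map (subtopology E' {e \<in> topspace E'. q e \<in> U})
      (prod_topology (subtopology B U) F) (\<phi> \<circ> h)"
    using \<phi> by (rule homeomorphic_map_compose)
  then show "\<exists>U \<phi>. openin B U \<and> b \<in> U \<and>
      homeomorphic_map (subtopology E' {e \<in> topspace E'. q e \<in> U})
        (prod_topology (subtopology B U) F) \<phi> \<and>
      (\<forall>e\<in>topspace E'. q e \<in> U \<longrightarrow> fst (\<phi> e) = q e)"
    using U fst q mem by (intro exI[of _ U] exI[of _ "\<phi> \<circ> h"]) auto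
qed

theorem theorem4p3:
  fixes B :: "'b topology" and F :: "'f topology" and E :: "'e topology" and p :: "'e \<Rightarrow> 'b"
  assumes "alexandroff_space B"
    and "fiber_bundle E B F p"
  shows "\<exists>(D :: 'b \<Rightarrow> 'e topology) (m :: 'b \<Rightarrow> 'b \<Rightarrow> 'e \<Rightarrow> 'e).
           top_functor B D m \<and> morphism_inverting B D m \<and>
           fiber_bundle (groth B D m) B F groth_proj \<and>
           bundles_isomorphic (groth B D m) groth_proj E p"
proof -
  \<comment> \<open>Packing the chart conditions into one predicate lets a single choice supply
    neighbourhood, trivialization and inverse at every point.\<close>
  define trivializes where "trivializes b U \<phi> \<psi> \<longleftrightarrow> openin B U \<and> b \<in> U \<and>
      homeomorphic_maps (subtopology E {e \<in> topspace E. p e \<in> U})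
        (prod_topology (subtopology B U) F) \<phi> \<psi> \<and>
      (\<forall>e\<in>topspace E. p e \<in> U \<longrightarrow> fst (\<phi> e) = p e)" for b U \<phi> \<psi>
  have "\<forall>b\<in>topspace B. \<exists>U \<phi> \<psi>. trivializes b U \<phi> \<psi>"
    using assms(2) unfolding fiber_bundle_def homeomorphic_map_maps trivializes_def by blast
  then obtain U \<phi> \<psi> where "\<forall>b\<in>topspace B. trivializes b (U b) (\<phi> b) (\<psi> b)"
    by metis
  note triv = this[unfolded trivializes_def]
  interpret trivialized_bundle B F E p U \<phi> \<psi>
    using assms triv by unfold_locales (simp_all add: fiber_bundle_def)
  have proj: "p (snd z) = groth_proj z" if "z \<in> topspace G" for z
    using that by (auto simp: topspace_G fib_def groth_proj_def)
  have "fiber_bundle G B F groth_proj"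
    using assms(2) homeomorphic_map_snd_G proj by (rule fiber_bundle_homeomorphic)
  moreover have "bundles_isomorphic G groth_proj E p"
    unfolding bundles_isomorphic_def using homeomorphic_map_snd_G proj by blast
  ultimately show ?thesis
    using top_functor_fibre morphism_inverting_fibre by blast
qed

end
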